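(* Let $F$ be the set of Freund bivariate mixture exponential densities $$f(x,y;\alpha_1,\beta_1,\alpha_2,\beta_2)=\begin{cases}\alpha_1\beta_2\,e^{-\beta_2 y-(\alpha_1+\alpha_2-\beta_2)x} & \text{for } 0\le x<y,\\ \alpha_2\beta_1\,e^{-\beta_1 x-(\alpha_1+\alpha_2-\beta_1)y} & \text{for } 0\le y\le x,\end{cases}$$ with $\alpha_i,\beta_i>0$ ($i=1,2$). Then: 1. Identifying $(\alpha_1,\beta_1,\alpha_2,\beta_2)$ as a local coordinate system, $F$ can be regarded as a $4$-manifold. 2. $F$ becomes a Riemannian manifold with the Fisher information metric $G=[g_{ij}]$, where $$g_{ij}=-\int_0^\infty\!\!\int_0^\infty \frac{\partial^2\log f(x,y)}{\partial x_i\,\partial x_j}\,f(x,y)\,dx\,dy,\qquad (x_1,x_2,x_3,x_4)=(\alpha_1,\beta_1,\alpha_2,\beta_2),$$ and it is given by $$[g_{ij}]=\begin{pmatrix}\frac{1}{\alpha_1^2+\alpha_1\alpha_2}&0&0&0\\0&\frac{\alpha_2}{\beta_1^2(\alpha_1+\alpha_2)}&0&0\\0&0&\frac{1}{\alpha_2^2+\alpha_1\alpha_2}&0\\0&0&0&\frac{\alpha_1}{\beta_2^2(\alpha_1+\alpha_2)}\end{pmatrix}.$$ 3. The inverse $[g^{ij}]$ of $[g_{ij}]$ is given by $$[g^{ij}]=\begin{pmatrix}\alpha_1^2+\alpha_1\alpha_2&0&0&0\\0&\frac{\beta_1^2(\alpha_1+\alpha_2)}{\alpha_2}&0&0\\0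&0&\alpha_2^2+\alpha_1\alpha_2&0\\0&0&0&\frac{\beta_2^2(\alpha_1+\alpha_2)}{\alpha_1}\end{pmatrix}.$$
   Context: Each $f(\cdot,\cdot;\alpha_1,\beta_1,\alpha_2,\beta_2)$ is a probability density on $[0,\infty)^2$; the parameter space is $(0,\infty)^4$. In the integral, partial derivatives are taken with respect to the parameters, separately on the two regions $x<y$ and $y\le x$. *)

theory Defs
  imports "HOL-Analysis.Analysis"
begin

section \<open>Smooth maps on open sets\<close>

primrec Ck_on :: "nat \<Rightarrow> 'a::real_normed_vector set \<Rightarrow> ('a \<Rightarrow> 'b::real_normed_vector) \<Rightarrow> bool" where
  "Ck_on 0 S f \<longleftrightarrow> continuous_on S f"
| "Ck_on (Suc k) S f \<longleftrightarrow>
     (\<forall>x\<in>S. f differentiable at x) \<and> (\<forall>v. Ck_on k S (\<lambda>x. frechet_derivative f (at x) v))"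

definition smooth_on :: "'a::real_normed_vector set \<Rightarrow> ('a \<Rightarrow> 'b::real_normed_vector) \<Rightarrow> bool" where
  "smooth_on S f \<longleftrightarrow> open S \<and> (\<forall>k. Ck_on k S f)"


section \<open>Smooth manifolds and Riemannian metrics\<close>

text \<open>A chart is a pair of a domain and a coordinate map; the values of the coordinate map
  outside the domain are irrelevant. The dimension of the manifold is the cardinality of
  the index type.\<close>

type_synonym ('a, 'n) chart = "'a set \<times> ('a \<Rightarrow> real ^ 'n)"

definition is_chart :: "'a topology \<Rightarrow> ('a, 'n::finite) chart \<Rightarrow> bool" where
  "is_chart X = (\<lambda>(U, \<phi>). openin X U \<and> open (\<phi> ` U) \<and>
     homeomorphic_map (subtopology X U) (top_of_set (\<phi> ` U)) \<phi>)"

definition smooth_atlas :: "'a topology \<Rightarrow> ('a, 'n::finite) chart set \<Rightarrow> bool" where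
  "smooth_atlas X \<A> \<longleftrightarrow>
     (\<forall>c\<in>\<A>. is_chart X c) \<and> (\<Union>(U, \<phi>)\<in>\<A>. U) = topspace X \<and>
     (\<forall>(U, \<phi>)\<in>\<A>. \<forall>(V, \<psi>)\<in>\<A>. smooth_on (\<phi> ` (U \<inter> V)) (\<psi> \<circ> inv_into U \<phi>))"

definition smooth_manifold :: "'a topology \<Rightarrow> ('a, 'n::finite) chart set \<Rightarrow> bool" where
  "smooth_manifold X \<A> \<longleftrightarrow> Hausdorff_space X \<and> second_countable X \<and> smooth_atlas X \<A>"

text \<open>A Riemannian metric, given classically by its component matrices: \<open>g c P\<close> is the matrix of
  the inner product on the tangent space at \<open>P\<close> with respect to the coordinate basis of the
  chart \<open>c\<close>. The last clause is the transformation law of a covariant 2-tensor.\<close>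

definition riemannian_metric ::
    "('a, 'n::finite) chart set \<Rightarrow> (('a, 'n) chart \<Rightarrow> 'a \<Rightarrow> real ^ 'n ^ 'n) \<Rightarrow> bool" where
  "riemannian_metric \<A> g \<longleftrightarrow>
     (\<forall>(U, \<phi>)\<in>\<A>.
        smooth_on (\<phi> ` U) (\<lambda>p. g (U, \<phi>) (inv_into U \<phi> p)) \<and>
        (\<forall>P\<in>U. transpose (g (U, \<phi>) P) = g (U, \<phi>) P \<and>
               (\<forall>v. v \<noteq> 0 \<longrightarrow> 0 < v \<bullet> (g (U, \<phi>) P *v v)))) \<and>
     (\<forall>(U, \<phi>)\<in>\<A>. \<forall>(V, \<psi>)\<in>\<A>. \<forall>P\<in>U \<inter> V.
        let J = matrix (frechet_derivative (\<psi> \<circ> inv_into U \<phi>) (at (\<phi> P)))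
        in g (U, \<phi>) P = transpose J ** g (V, \<psi>) P ** J)"

definition riemannian_manifold ::
    "'a topology \<Rightarrow> ('a, 'n::finite) chart set \<Rightarrow> (('a, 'n) chart \<Rightarrow> 'a \<Rightarrow> real ^ 'n ^ 'n) \<Rightarrow> bool" where
  "riemannian_manifold X \<A> g \<longleftrightarrow> smooth_manifold X \<A> \<and> riemannian_metric \<A> g"


section \<open>Fisher information of a parametrised family of densities on the quadrant\<close>

definition partial :: "'n::finite \<Rightarrow> (real ^ 'n \<Rightarrow> real) \<Rightarrow> real ^ 'n \<Rightarrow> real" where
  "partial i h p = deriv (\<lambda>t. h (p + t *\<^sub>R axis i 1)) 0"

definition fisher_integrand ::
    "(real ^ 'n::finite \<Rightarrow> real \<Rightarrow> real \<Rightarrow> real) \<Rightarrow> real ^ 'n \<Rightarrow> 'n \<Rightarrow> 'n \<Rightarrow> real \<Rightarrow> real \<Rightarrow> real" where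
  "fisher_integrand f p i j x y = partial i (partial j (\<lambda>q. ln (f q x y))) p * f p x y"

definition fisher_information ::
    "(real ^ 'n::finite \<Rightarrow> real \<Rightarrow> real \<Rightarrow> real) \<Rightarrow> real ^ 'n \<Rightarrow> real ^ 'n ^ 'n" where
  "fisher_information f p =
     (\<chi> i j. - (LBINT y:{0..}. (LBINT x:{0..}. fisher_integrand f p i j x y)))"

text \<open>On a manifold whose points are themselves densities, the inverse of a chart is a
  parametrised family of densities.\<close>

definition fisher_metric ::
    "(real \<Rightarrow> real \<Rightarrow> real, 'n::finite) chart \<Rightarrow> (real \<Rightarrow> real \<Rightarrow> real) \<Rightarrow> real ^ 'n ^ 'n" where
  "fisher_metric = (\<lambda>(U, \<phi>) P. fisher_information (inv_into U \<phi>) (\<phi> P))"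


section \<open>Freund bivariate mixture exponential densities\<close>

text \<open>The densities live on the closed quadrant; as functions on the plane they are extended by 0.\<close>

definition freund_density :: "real \<Rightarrow> real \<Rightarrow> real \<Rightarrow> real \<Rightarrow> real \<Rightarrow> real \<Rightarrow> real" where
  "freund_density \<alpha>1 \<beta>1 \<alpha>2 \<beta>2 x y =
     (if 0 \<le> x \<and> x < y then \<alpha>1 * \<beta>2 * exp (- \<beta>2 * y - (\<alpha>1 + \<alpha>2 - \<beta>2) * x)
      else if 0 \<le> y \<and> y \<le> x then \<alpha>2 * \<beta>1 * exp (- \<beta>1 * x - (\<alpha>1 + \<alpha>2 - \<beta>1) * y)
      else 0)"

text \<open>Coordinates are ordered \<open>(\<alpha>1, \<beta>1, \<alpha>2, \<beta>2)\<close>.\<close>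

definition freund :: "real ^ 4 \<Rightarrow> real \<Rightarrow> real \<Rightarrow> real" where
  "freund p = freund_density (p $ 1) (p $ 2) (p $ 3) (p $ 4)"

definition freund_params :: "(real ^ 4) set" where
  "freund_params = {p. \<forall>i. 0 < p $ i}"

definition freund_family :: "(real \<Rightarrow> real \<Rightarrow> real) set" where
  "freund_family = freund ` freund_params"

definition freund_coords :: "(real \<Rightarrow> real \<Rightarrow> real) \<Rightarrow> real ^ 4" where
  "freund_coords = inv_into freund_params freund"

definition freund_topology :: "(real \<Rightarrow> real \<Rightarrow> real) topology" where
  "freund_topology = pullback_topology freund_family freund_coords euclidean"

definition freund_atlas :: "(real \<Rightarrow> real \<Rightarrow> real, 4) chart set" where
  "freund_atlas = {(freund_family, freund_coords)}"

end

theory Submission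
  imports Defs
begin

text \<open>On each of the regions \<open>x < y\<close> and \<open>y \<le> x\<close> the log-density is the sum of the logarithms of
  two parameters and a linear function of all of them. Its Hessian is therefore diagonal and
  constant on each region, with entries \<open>- 1 / p\<^sub>i\<^sup>2\<close>, and the Fisher information only needs the masses
  \<open>\<alpha>1 / (\<alpha>1 + \<alpha>2)\<close> and \<open>\<alpha>2 / (\<alpha>1 + \<alpha>2)\<close> of the two regions. The densities determine
  their parameters through their values on the axes, so the parameters are a global chart and the
  manifold structure is that of an open subset of Euclidean space.\<close>

section \<open>Calculus of smooth maps\<close>

lemma Ck_on_imp_continuous_on: "Ck_on k S f \<Longrightarrow> continuous_on S f"
  by (cases k) (auto intro!: continuous_at_imp_continuous_on differentiable_imp_continuous_within)

text \<open>The recursion at \<open>Suc k\<close> speaks only of derivatives, so lowering the order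
  takes an induction down to the fact that differentiable maps are continuous.\<close>

lemma Ck_on_Suc_imp: "Ck_on (Suc k) S f \<Longrightarrow> Ck_on k S f"
proof (induction k arbitrary: f)
  case 0
  from Ck_on_imp_continuous_on[OF this] show ?case by simp
next
  case (Suc k)
  then show ?case by (metis Ck_on.simps(2))
qed

text \<open>Derivatives at a point of an open set see only values on that set, so maps built from
  \<open>inv_into\<close> can be exchanged for formulas valid on \<open>S\<close> alone.\<close>

lemma Ck_on_cong:
  assumes "open S" "\<And>x. x \<in> S \<Longrightarrow> f x = g x" "Ck_on k S f"
  shows "Ck_on k S g"
  using assms(2,3)
proof (induction k arbitrary: f g)
  case 0
  then show ?case by (simp cong: continuous_on_cong)
next
  case (Suc k)
  have "g differentiable at x" if "x \<in> S" for x
    using Suc.prems that assms(1) unfolding differentiable_def Ck_on.simps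
    by (meson has_derivative_transform_within_open)
  moreover have "frechet_derivative f (at x) v = frechet_derivative g (at x) v" if "x \<in> S" for x v
    using Suc.prems that assms(1) frechet_derivative_transform_within_open[of f x S g] by auto
  ultimately show ?case
    using Suc by (auto intro: Suc.IH[of "\<lambda>x. frechet_derivative f (at x) v" for v])
qed

text \<open>Uniqueness of the derivative lets an explicit \<open>f'\<close> stand for the
  choice-based \<open>frechet_derivative\<close>.\<close>

lemma Ck_on_SucI:
  assumes "open S" "\<And>x. x \<in> S \<Longrightarrow> (f has_derivative f' x) (at x)" "\<And>v. Ck_on k S (\<lambda>x. f' x v)"
  shows "Ck_on (Suc k) S f"
proof -
  have "f' x v = frechet_derivative f (at x) v" if "x \<in> S" for x v
    using frechet_derivative_at[OF assms(2)[OF that]] by simp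
  then show ?thesis
    using assms by (auto simp: differentiable_def intro: Ck_on_cong[of S "\<lambda>x. f' x v" for v])
qed

lemma Ck_on_SucD:
  assumes "Ck_on (Suc k) S f" "x \<in> S"
  shows "(f has_derivative frechet_derivative f (at x)) (at x)"
  using assms by (simp add: frechet_derivative_works)

lemma Ck_on_const: "open S \<Longrightarrow> Ck_on k S (\<lambda>x. c)"
  by (induction k arbitrary: c) auto

lemma Ck_on_bounded_linear:
  assumes "open S" "bounded_linear L"
  shows "Ck_on k S L"
proof (cases k)
  case 0
  then show ?thesis using assms by (simp add: linear_continuous_on)
next
  case (Suc m)
  show ?thesis unfolding Suc
    by (rule Ck_on_SucI[where f' = "\<lambda>x. L"])
      (use assms in \<open>auto intro: bounded_linear_imp_has_derivative Ck_on_const\<close>)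
qed

lemma Ck_on_compose_bounded_linear:
  assumes "open S" "bounded_linear L" "Ck_on k S f"
  shows "Ck_on k S (\<lambda>x. L (f x))"
  using assms(3)
proof (induction k arbitrary: f)
  case 0
  then show ?case using assms by (auto intro: bounded_linear.continuous_on)
next
  case (Suc k)
  show ?case
    by (rule Ck_on_SucI[where f' = "\<lambda>x v. L (frechet_derivative f (at x) v)"])
      (use Suc.prems in \<open>auto intro: assms Suc.IH bounded_linear.has_derivative[OF assms(2)]
         Ck_on_SucD[OF Suc.prems]\<close>)
qed

lemma Ck_on_add:
  assumes "open S" "Ck_on k S f" "Ck_on k S g"
  shows "Ck_on k S (\<lambda>x. f x + g x)"
  using assms(2,3)
proof (induction k arbitrary: f g)
  case 0
  then show ?case by (auto intro: continuous_on_add)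
next
  case (Suc k)
  show ?case
  proof (rule Ck_on_SucI[OF assms(1)])
    show "((\<lambda>x. f x + g x) has_derivative
            (\<lambda>v. frechet_derivative f (at x) v + frechet_derivative g (at x) v)) (at x)" if "x \<in> S" for x
      using that Suc.prems by (intro has_derivative_add Ck_on_SucD)
  qed (use Suc in auto)
qed

lemma Ck_on_sum:
  assumes "open S" "finite I" "\<And>i. i \<in> I \<Longrightarrow> Ck_on k S (f i)"
  shows "Ck_on k S (\<lambda>x. \<Sum>i\<in>I. f i x)"
  using assms(2,3)
  by (induction I) (auto intro: Ck_on_const Ck_on_add assms(1))

lemma Ck_on_mult:
  fixes f g :: "'a::real_normed_vector \<Rightarrow> real"
  assumes "open S" "Ck_on k S f" "Ck_on k S g"
  shows "Ck_on k S (\<lambda>x. f x * g x)"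
  using assms(2,3)
proof (induction k arbitrary: f g)
  case 0
  then show ?case by (auto intro: continuous_on_mult)
next
  case (Suc k)
  show ?case
  proof (rule Ck_on_SucI[OF assms(1)])
    show "((\<lambda>x. f x * g x) has_derivative
            (\<lambda>v. f x * frechet_derivative g (at x) v + frechet_derivative f (at x) v * g x)) (at x)"
      if "x \<in> S" for x
      using that Suc.prems by (intro has_derivative_mult Ck_on_SucD)
    show "Ck_on k S (\<lambda>x. f x * frechet_derivative g (at x) v + frechet_derivative f (at x) v * g x)" for v
      using Suc.prems Suc.prems[THEN Ck_on_Suc_imp] by (intro Ck_on_add Suc.IH assms(1)) auto
  qed
qed

lemma Ck_on_inverse:
  fixes f :: "'a::real_normed_vector \<Rightarrow> real"
  assumes "open S" "Ck_on k S f" "\<And>x. x \<in> S \<Longrightarrow> f x \<noteq> 0"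
  shows "Ck_on k S (\<lambda>x. inverse (f x))"
  using assms(2,3)
proof (induction k arbitrary: f)
  case 0
  then show ?case by (auto intro: continuous_on_inverse)
next
  case (Suc k)
  show ?case
  proof (rule Ck_on_SucI[OF assms(1)])
    \<comment> \<open>The sign is written as a factor \<open>-1\<close>, so that the product lemma
      covers the whole derivative.\<close>
    show "((\<lambda>x. inverse (f x)) has_derivative
            (\<lambda>v. -1 * (inverse (f x) * (frechet_derivative f (at x) v * inverse (f x))))) (at x)"
      if "x \<in> S" for x
      using Deriv.has_derivative_inverse[OF _ Ck_on_SucD[OF Suc.prems(1) that]] Suc.prems(2)[OF that]
      by (simp add: mult.assoc)
    show "Ck_on k S (\<lambda>x. -1 * (inverse (f x) * (frechet_derivative f (at x) v * inverse (f x))))" for v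
      using Suc.prems Suc.IH[OF Ck_on_Suc_imp[OF Suc.prems(1)]]
      by (intro Ck_on_mult Ck_on_const assms(1)) auto
  qed
qed

lemma Ck_on_ln:
  fixes f :: "'a::real_normed_vector \<Rightarrow> real"
  assumes "open S" "Ck_on k S f" "\<And>x. x \<in> S \<Longrightarrow> 0 < f x"
  shows "Ck_on k S (\<lambda>x. ln (f x))"
proof (cases k)
  case 0
  then show ?thesis using assms by (auto intro!: continuous_on_ln dest: assms(3))
next
  case (Suc m)
  show ?thesis unfolding Suc
  proof (rule Ck_on_SucI[OF assms(1)])
    show "((\<lambda>x. ln (f x)) has_derivative (\<lambda>v. frechet_derivative f (at x) v * inverse (f x))) (at x)"
      if "x \<in> S" for x
      using has_derivative_ln[OF assms(3)[OF that] Ck_on_SucD[OF assms(2)[unfolded Suc] that]]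
      by (simp add: divide_inverse)
    show "Ck_on m S (\<lambda>x. frechet_derivative f (at x) v * inverse (f x))" for v
    proof (intro Ck_on_mult Ck_on_inverse assms(1))
      show "f x \<noteq> 0" if "x \<in> S" for x
        using assms(3)[OF that] by simp
    qed (use assms(2)[unfolded Suc] Ck_on_Suc_imp in auto)
  qed
qed

text \<open>A vector map is the sum of its components placed along the axes, each a bounded linear
  image of a scalar map.\<close>

lemma Ck_on_vec:
  fixes f :: "'a::real_normed_vector \<Rightarrow> 'b::real_normed_vector ^ 'n::finite"
  assumes "open S" "\<And>i. Ck_on k S (\<lambda>x. f x $ i)"
  shows "Ck_on k S f"
proof -
  have "bounded_linear (axis i :: 'b \<Rightarrow> 'b ^ 'n)" for i
    by (rule bounded_linear_intro[where K = 1])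
      (auto simp: axis_def vec_eq_iff norm_vec_def L2_set_def if_distrib if_distribR sum.delta cong: if_cong)
  then have "Ck_on k S (\<lambda>x. \<Sum>i\<in>UNIV. axis i (f x $ i))"
    by (intro Ck_on_sum Ck_on_compose_bounded_linear[of S "axis i" for i] assms) auto
  moreover have "(\<Sum>i\<in>UNIV. axis i (f x $ i)) = f x" for x
    by (simp add: vec_eq_iff axis_def if_distrib cong: if_cong)
  ultimately show ?thesis by simp
qed

lemma Ck_on_nth: "open S \<Longrightarrow> Ck_on k S (\<lambda>x :: real ^ 'n::finite. x $ i)"
  by (intro Ck_on_bounded_linear bounded_linear_vec_nth)

section \<open>Partial derivatives and Fisher information\<close>

lemma partial_cong:
  assumes "open S" "p \<in> S" "\<And>q. q \<in> S \<Longrightarrow> h q = k q"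
  shows "partial i h p = partial i k p"
proof -
  have "continuous (at 0) (\<lambda>t. p + t *\<^sub>R axis i (1::real))"
    by (intro continuous_intros)
  then have "((\<lambda>t. p + t *\<^sub>R axis i (1::real)) \<longlongrightarrow> p) (at 0)"
    by (simp add: continuous_at)
  \<comment> \<open>\<open>deriv_cong_ev\<close> asks for agreement at \<open>t = 0\<close> too,
    hence the passage from \<open>at 0\<close> to \<open>nhds 0\<close>.\<close>
  moreover have "p + 0 *\<^sub>R axis i (1::real) = p" by simp
  ultimately have "((\<lambda>t. p + t *\<^sub>R axis i (1::real)) \<longlongrightarrow> p) (nhds 0)"
    by (metis (no_types, lifting) tendsto_at_iff_tendsto_nhds)
  then have "\<forall>\<^sub>F t in nhds 0. p + t *\<^sub>R axis i 1 \<in> S"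
    using assms(1,2) by (rule topological_tendstoD)
  then have "\<forall>\<^sub>F t in nhds 0. h (p + t *\<^sub>R axis i 1) = k (p + t *\<^sub>R axis i 1)"
    by eventually_elim (rule assms(3))
  then show ?thesis unfolding partial_def by (intro deriv_cong_ev) auto
qed

lemma second_partial_cong:
  assumes "open S" "p \<in> S" "\<And>q. q \<in> S \<Longrightarrow> h q = k q"
  shows "partial i (partial j h) p = partial i (partial j k) p"
  by (intro partial_cong[OF assms(1,2)] partial_cong[OF assms(1) _ assms(3)])

lemma fisher_information_cong:
  assumes "open S" "p \<in> S" "\<And>q. q \<in> S \<Longrightarrow> f q = g q"
  shows "fisher_information f p = fisher_information g p"
proof -
  have "partial i (partial j (\<lambda>q. ln (f q x y))) p = partial i (partial j (\<lambda>q. ln (g q x y))) p" for i j x y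
    by (rule second_partial_cong[OF assms(1,2)]) (simp add: assms(3))
  then show ?thesis
    by (simp add: fisher_information_def fisher_integrand_def assms)
qed

lemma partial_eq_has_derivative:
  assumes "(h has_derivative h') (at p)"
  shows "partial i h p = h' (axis i 1)"
proof -
  interpret h': bounded_linear h' using assms by (rule has_derivative_bounded_linear)
  have "((\<lambda>t. p + t *\<^sub>R axis i 1) has_derivative (\<lambda>t. t *\<^sub>R axis i 1)) (at (0::real))"
    by (auto intro!: derivative_eq_intros)
  then have "((\<lambda>t. h (p + t *\<^sub>R axis i 1)) has_derivative (\<lambda>t. h' (t *\<^sub>R axis i 1))) (at (0::real))"
    by (rule has_derivative_compose) (simp add: assms)
  then have "((\<lambda>t. h (p + t *\<^sub>R axis i 1)) has_real_derivative h' (axis i 1)) (at 0)"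
    by (simp add: has_field_derivative_def h'.scaleR mult_commute_abs)
  then show ?thesis unfolding partial_def by (rule DERIV_imp_deriv)
qed

section \<open>Diagonal matrices\<close>

definition diagonal :: "('n \<Rightarrow> real) \<Rightarrow> real ^ 'n ^ 'n::finite" where
  "diagonal d = (\<chi> i j. if i = j then d i else 0)"

lemma diagonal_mult_vec_nth [simp]: "(diagonal d *v v) $ i = d i * v $ i"
  by (simp add: diagonal_def matrix_vector_mult_def if_distrib if_distribR cong: if_cong)

lemma transpose_diagonal [simp]: "transpose (diagonal d) = diagonal d"
  by (auto simp: diagonal_def transpose_def vec_eq_iff)

lemma diagonal_mult: "diagonal d ** diagonal e = diagonal (\<lambda>i. d i * e i)"
  by (auto simp: diagonal_def matrix_matrix_mult_def vec_eq_iff mult_delta_left)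

lemma diagonal_eq_mat_1: "(\<And>i. d i = 1) \<Longrightarrow> diagonal d = mat 1"
  by (auto simp: diagonal_def mat_def vec_eq_iff)

lemma diagonal_pos_def:
  assumes "\<And>i. 0 < d i" "v \<noteq> 0"
  shows "0 < v \<bullet> (diagonal d *v v)"
proof -
  obtain k where "v $ k \<noteq> 0" using assms(2) by (auto simp: vec_eq_iff)
  have "v \<bullet> (diagonal d *v v) = (\<Sum>i\<in>UNIV. d i * (v $ i)\<^sup>2)"
    by (simp add: inner_vec_def power2_eq_square mult_ac)
  also have "\<dots> > 0"
    using \<open>v $ k \<noteq> 0\<close> assms(1) by (intro sum_pos2[of _ k]) (auto simp: less_imp_le)
  finally show ?thesis .
qed

lemma invertible_diagonal:
  assumes "\<And>i. d i \<noteq> 0"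
  shows "invertible (diagonal d)" "matrix_inv (diagonal d) = diagonal (\<lambda>i. 1 / d i)"
proof -
  have inv: "diagonal d ** diagonal (\<lambda>i. 1 / d i) = mat 1" "diagonal (\<lambda>i. 1 / d i) ** diagonal d = mat 1"
    using assms by (simp_all add: diagonal_mult diagonal_eq_mat_1)
  then show *: "invertible (diagonal d)"
    unfolding invertible_def by blast
  \<comment> \<open>\<open>matrix_inv\<close> is a choice; multiplying by the known right inverse
    and cancelling on the left identifies it.\<close>
  have "matrix_inv (diagonal d) = matrix_inv (diagonal d) ** (diagonal d ** diagonal (\<lambda>i. 1 / d i))"
    by (simp add: inv)
  also have "\<dots> = diagonal (\<lambda>i. 1 / d i)"
    using someI_ex[OF *[unfolded invertible_def]] by (simp add: matrix_mul_assoc matrix_inv_def)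
  finally show "matrix_inv (diagonal d) = diagonal (\<lambda>i. 1 / d i)" .
qed

lemma vector_4:
  "(vector [x, y, z, w] :: 'a::zero ^ 4) $ 1 = x"
  "(vector [x, y, z, w] :: 'a::zero ^ 4) $ 2 = y"
  "(vector [x, y, z, w] :: 'a::zero ^ 4) $ 3 = z"
  "(vector [x, y, z, w] :: 'a::zero ^ 4) $ 4 = w"
  by (simp_all add: vector_def)

lemma diagonal_4:
  "diagonal d = (vector [vector [d 1, 0, 0, 0], vector [0, d 2, 0, 0],
     vector [0, 0, d 3, 0], vector [0, 0, 0, d 4]] :: real ^ 4 ^ 4)"
  by (simp add: vec_eq_iff forall_4 vector_4 diagonal_def)

section \<open>Integrals over a sector\<close>

text \<open>The lower limit is general: it is \<open>u\<close> for the inner integral over a sector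
  and 0 for the outer one.\<close>

lemma nn_integral_exp_tail:
  fixes a b :: real
  assumes "0 < b"
  shows "(\<integral>\<^sup>+v. ennreal (exp (- b * v)) * indicator {a..} v \<partial>lborel) = ennreal (exp (- b * a) / b)"
proof -
  have "(\<integral>\<^sup>+v. ennreal (exp (- b * v)) * indicator {a..} v \<partial>lborel) = ennreal (0 - (- exp (- b * a) / b))"
  proof (rule nn_integral_FTC_atLeast[where F = "\<lambda>v. - exp (- b * v) / b"])
    show "((\<lambda>v. - exp (- b * v) / b) \<longlongrightarrow> 0) at_top"
    proof -
      have "filterlim (\<lambda>v. - b * v) at_bot at_top"
        using filterlim_tendsto_pos_mult_at_top[OF tendsto_const assms filterlim_ident]
        by (simp add: filterlim_uminus_at_bot)
      from filterlim_compose[OF exp_at_bot this]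
      have "((\<lambda>v. exp (- b * v)) \<longlongrightarrow> 0) at_top" .
      from tendsto_divide[OF tendsto_minus[OF this] tendsto_const[of b]] assms show ?thesis by simp
    qed
  qed (use assms in \<open>auto intro!: derivative_eq_intros\<close>)
  then show ?thesis by simp
qed

text \<open>The flag \<open>w\<close> says whether the diagonal belongs to the sector.\<close>

definition sector_exp :: "bool \<Rightarrow> real \<Rightarrow> real \<Rightarrow> real \<Rightarrow> real \<Rightarrow> real" where
  "sector_exp w b s u v =
     (if 0 \<le> u \<and> (u < v \<or> w \<and> u = v) then exp (- b * v - (s - b) * u) else 0)"

lemma sector_exp_measurable [measurable]:
  "(\<lambda>(u, v). sector_exp w b s u v) \<in> borel_measurable (lborel \<Otimes>\<^sub>M lborel)"
  unfolding sector_exp_def by measurable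

text \<open>Tonelli: integrating \<open>v\<close> from \<open>u\<close> to infinity leaves
  \<open>exp (- s * u) / b\<close>, and the integral over \<open>u \<ge> 0\<close> supplies
  \<open>1 / s\<close>.\<close>

lemma has_bochner_integral_sector_exp:
  assumes "0 < b" "0 < s"
  shows "has_bochner_integral (lborel \<Otimes>\<^sub>M lborel) (\<lambda>(u, v). sector_exp w b s u v) (1 / (b * s))"
proof (rule has_bochner_integral_nn_integral)
  \<comment> \<open>integrating first over the unbounded variable \<open>v\<close> avoids dividing by \<open>s - b\<close>, which may vanish\<close>
  have inner: "(\<integral>\<^sup>+v. ennreal (sector_exp w b s u v) \<partial>lborel)
      = ennreal (1 / b) * (ennreal (exp (- s * u)) * indicator {0..} u)" for u
  proof -
    have "(\<integral>\<^sup>+v. ennreal (sector_exp w b s u v) \<partial>lborel)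
        = (\<integral>\<^sup>+v. (ennreal (exp (- (s - b) * u)) * indicator {0..} u)
              * (ennreal (exp (- b * v)) * indicator {u..} v) \<partial>lborel)"
    proof (rule nn_integral_cong_AE)
      show "AE v in lborel. ennreal (sector_exp w b s u v)
          = (ennreal (exp (- (s - b) * u)) * indicator {0..} u) * (ennreal (exp (- b * v)) * indicator {u..} v)"
        \<comment> \<open>The point \<open>v = u\<close> is null, so the open and the closed sector
          agree almost everywhere.\<close>
        using AE_lborel_singleton[of u]
        by eventually_elim
          (auto simp: sector_exp_def indicator_def algebra_simps simp flip: ennreal_mult exp_add)
    qed
    also have "\<dots> = (ennreal (exp (- (s - b) * u)) * indicator {0..} u) * ennreal (exp (- b * u) / b)"
      by (subst nn_integral_cmult) (use nn_integral_exp_tail[OF assms(1)] in auto)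
    also have "\<dots> = ennreal (1 / b) * (ennreal (exp (- s * u)) * indicator {0..} u)"
      using assms by (auto simp: indicator_def algebra_simps simp flip: ennreal_mult exp_add)
    finally show ?thesis .
  qed
  have "(\<integral>\<^sup>+z. ennreal (case z of (u, v) \<Rightarrow> sector_exp w b s u v) \<partial>(lborel \<Otimes>\<^sub>M lborel))
      = (\<integral>\<^sup>+u. \<integral>\<^sup>+v. ennreal (sector_exp w b s u v) \<partial>lborel \<partial>lborel)"
    by (subst lborel.nn_integral_fst[symmetric]) auto
  also have "\<dots> = ennreal (1 / b) * ennreal (exp (- s * 0) / s)"
    unfolding inner by (subst nn_integral_cmult) (use nn_integral_exp_tail[OF assms(2), of 0] in auto)
  also have "\<dots> = ennreal (1 / (b * s))"
    using assms by (simp flip: ennreal_mult)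
  finally show "(\<integral>\<^sup>+z. ennreal (case z of (u, v) \<Rightarrow> sector_exp w b s u v) \<partial>(lborel \<Otimes>\<^sub>M lborel))
      = ennreal (1 / (b * s))" .
qed (use assms in \<open>auto simp: sector_exp_def\<close>)

text \<open>Carries the sector formula to the region \<open>y \<le> x\<close>, where the variables
  exchange roles.\<close>

lemma has_bochner_integral_swap_lborel:
  fixes f :: "real \<Rightarrow> real \<Rightarrow> real"
  assumes "has_bochner_integral (lborel \<Otimes>\<^sub>M lborel) (\<lambda>(x, y). f x y) c"
  shows "has_bochner_integral (lborel \<Otimes>\<^sub>M lborel) (\<lambda>(x, y). f y x) c"
  using assms lborel_pair.integrable_product_swap[of "\<lambda>(x, y). f x y"]
    lborel_pair.integral_product_swap[of "\<lambda>(x, y). f x y"]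
  by (auto simp: has_bochner_integral_iff)

section \<open>Fisher information of the Freund densities\<close>

lemma open_freund_params: "open freund_params"
proof -
  have eq: "freund_params = (\<Inter>i. {p. 0 < p $ i})"
    by (auto simp: freund_params_def)
  show ?thesis
    unfolding eq by (auto intro!: open_INT open_Collect_less continuous_intros)
qed

lemma freund_params_pos: "p \<in> freund_params \<Longrightarrow> 0 < p $ i"
  by (simp add: freund_params_def)

text \<open>The log-density is nonlinear in \<open>\<alpha>1\<close> and \<open>\<beta>2\<close> only on \<open>x < y\<close>, and in \<open>\<beta>1\<close> and \<open>\<alpha>2\<close> only on
  \<open>y \<le> x\<close>; \<open>freund_part p i\<close> is the density cut off to the region belonging to parameter \<open>i\<close>.\<close>

definition freund_part :: "real ^ 4 \<Rightarrow> 4 \<Rightarrow> real \<Rightarrow> real \<Rightarrow> real" where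
  "freund_part p i x y =
     (if i = 1 \<or> i = 4 then p $ 1 * p $ 4 * sector_exp False (p $ 4) (p $ 1 + p $ 3) x y
      else p $ 3 * p $ 2 * sector_exp True (p $ 2) (p $ 1 + p $ 3) y x)"

lemma has_bochner_integral_freund_part:
  assumes "p \<in> freund_params"
  shows "has_bochner_integral (lborel \<Otimes>\<^sub>M lborel) (\<lambda>(x, y). freund_part p i x y)
           ((if i = 1 \<or> i = 4 then p $ 1 else p $ 3) / (p $ 1 + p $ 3))"
proof -
  note pos = freund_params_pos[OF assms]
  have s: "0 < p $ 1 + p $ 3" using pos by (simp add: add_pos_pos)
  have eq: "p $ a * p $ b * (1 / (p $ b * s)) = p $ a / s" for a b s
    using pos[of b] by simp
  have 1: "has_bochner_integral (lborel \<Otimes>\<^sub>M lborel)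
      (\<lambda>(x, y). p $ a * p $ b * sector_exp w (p $ b) (p $ 1 + p $ 3) x y) (p $ a / (p $ 1 + p $ 3))" for a b w
    using has_bochner_integral_mult_right[OF has_bochner_integral_sector_exp[OF pos s],
        of "p $ a * p $ b" w b] unfolding eq
    by (simp add: case_prod_unfold)
  show ?thesis
    \<comment> \<open>Coordinates 1 and 4 are \<alpha>1 and \<beta>2, acting on
      \<open>x < y\<close>; 3 and 2 are \<alpha>2 and \<beta>1, acting on \<open>y \<le> x\<close>,
      which contains the diagonal.\<close>
    using 1[of 1 4 False] has_bochner_integral_swap_lborel[OF 1[of 3 2 True]]
    by (simp add: freund_part_def)
qed

text \<open>The function is the log-density of one region, with rate \<open>q $ b\<close>, smaller
  variable \<open>u\<close> and larger variable \<open>v\<close>. Only the two logarithms survive,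
  and adding their indicators stays correct for \<open>a = b\<close>.\<close>

lemma second_partial_log_sector:
  assumes "p \<in> freund_params"
  shows "partial i (partial j (\<lambda>q. ln (q $ a) + ln (q $ b) - q $ b * v - (q $ 1 + q $ 3 - q $ b) * u)) p
       = - (if i = j then (of_bool (i = a) + of_bool (i = b)) / (p $ i)\<^sup>2 else 0)"
proof -
  let ?e = "\<lambda>j. axis j (1::real) :: real ^ 4"
  have "partial j (\<lambda>q. ln (q $ a) + ln (q $ b) - q $ b * v - (q $ 1 + q $ 3 - q $ b) * u) q
      = ?e j $ a / q $ a + ?e j $ b / q $ b - ?e j $ b * v - (?e j $ 1 + ?e j $ 3 - ?e j $ b) * u"
    if "q \<in> freund_params" for q
    by (rule partial_eq_has_derivative[where h' = "\<lambda>e. e $ a / q $ a + e $ b / q $ b - e $ b * v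
          - (e $ 1 + e $ 3 - e $ b) * u", THEN trans])
      (use freund_params_pos[OF that] in \<open>auto intro!: derivative_eq_intros bounded_linear_imp_has_derivative
         simp: divide_inverse\<close>)
  \<comment> \<open>The first derivative is known on the whole open parameter set, so it may be
    differentiated again at \<open>p\<close>.\<close>
  then have "partial i (partial j (\<lambda>q. ln (q $ a) + ln (q $ b) - q $ b * v - (q $ 1 + q $ 3 - q $ b) * u)) p
      = partial i (\<lambda>q. ?e j $ a / q $ a + ?e j $ b / q $ b - ?e j $ b * v - (?e j $ 1 + ?e j $ 3 - ?e j $ b) * u) p"
    by (rule partial_cong[OF open_freund_params assms])
  also have "\<dots> = - (?e j $ a * ?e i $ a / (p $ a)\<^sup>2) - ?e j $ b * ?e i $ b / (p $ b)\<^sup>2"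
    by (rule partial_eq_has_derivative[where h' = "\<lambda>e. - (?e j $ a * e $ a / (p $ a)\<^sup>2)
          - ?e j $ b * e $ b / (p $ b)\<^sup>2", THEN trans])
      (use freund_params_pos[OF assms] in \<open>auto intro!: derivative_eq_intros bounded_linear_imp_has_derivative
         simp: power2_eq_square divide_inverse mult_ac fun_eq_iff order.strict_implies_not_eq[symmetric]\<close>)
  also have "\<dots> = - (if i = j then (of_bool (i = a) + of_bool (i = b)) / (p $ i)\<^sup>2 else 0)"
    by (auto simp: axis_def add_divide_distrib)
  finally show ?thesis .
qed

lemma ln_freund_lower:
  assumes "0 \<le> x" "x < y" "q \<in> freund_params"
  shows "ln (freund q x y) = ln (q $ 1) + ln (q $ 4) - q $ 4 * y - (q $ 1 + q $ 3 - q $ 4) * x"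
  using assms freund_params_pos[OF assms(3)]
  by (simp add: freund_def freund_density_def ln_mult less_imp_neq[symmetric])

lemma ln_freund_upper:
  assumes "0 \<le> y" "y \<le> x" "q \<in> freund_params"
  shows "ln (freund q x y) = ln (q $ 3) + ln (q $ 2) - q $ 2 * x - (q $ 1 + q $ 3 - q $ 2) * y"
  using assms freund_params_pos[OF assms(3)]
  by (simp add: freund_def freund_density_def ln_mult less_imp_neq[symmetric])

text \<open>The \<open>i\<close>-th diagonal Hessian entry is nonzero only on the region belonging
  to \<open>i\<close>, so multiplying by the density cuts the density off to that region.\<close>

lemma fisher_integrand_freund:
  assumes "p \<in> freund_params"
  shows "fisher_integrand freund p i j x y = (if i = j then - freund_part p i x y / (p $ i)\<^sup>2 else 0)"
proof -
  note cong = second_partial_cong[OF open_freund_params assms]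
  consider (lower) "0 \<le> x" "x < y" | (upper) "0 \<le> y" "y \<le> x" | (out) "x < 0 \<or> y < 0"
    by linarith
  then show ?thesis
  proof cases
    case lower
    have "partial i (partial j (\<lambda>q. ln (freund q x y))) p
        = - (if i = j then (of_bool (i = 1) + of_bool (i = 4)) / (p $ i)\<^sup>2 else 0)"
      using cong[OF ln_freund_lower[OF lower]] second_partial_log_sector[OF assms] by simp
    then show ?thesis
      unfolding fisher_integrand_def
      using lower exhaust_4[of i]
      by (auto simp: freund_part_def freund_def freund_density_def sector_exp_def)
  next
    case upper
    have "partial i (partial j (\<lambda>q. ln (freund q x y))) p
        = - (if i = j then (of_bool (i = 3) + of_bool (i = 2)) / (p $ i)\<^sup>2 else 0)"
      using cong[OF ln_freund_upper[OF upper]] second_partial_log_sector[OF assms] by simp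
    then show ?thesis
      unfolding fisher_integrand_def
      using upper exhaust_4[of i]
      by (auto simp: freund_part_def freund_def freund_density_def sector_exp_def)
  next
    \<comment> \<open>The density factor is 0 here, so the product is 0 whatever the derivatives of
      \<open>ln 0\<close> are.\<close>
    case out
    then show ?thesis
      by (auto simp: fisher_integrand_def freund_part_def freund_def freund_density_def sector_exp_def)
  qed
qed

text \<open>The mass of the region belonging to \<open>i\<close> times
  \<open>1 / (p $ i)\<^sup>2\<close>, kept in one formula for all four parameters.\<close>

definition freund_fisher_entry :: "real ^ 4 \<Rightarrow> 4 \<Rightarrow> real" where
  "freund_fisher_entry p i =
     (if i = 1 \<or> i = 4 then p $ 1 else p $ 3) / ((p $ 1 + p $ 3) * (p $ i)\<^sup>2)"

lemma has_bochner_integral_fisher_integrand_freund: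
  assumes "p \<in> freund_params"
  shows "has_bochner_integral (lborel \<Otimes>\<^sub>M lborel) (\<lambda>(x, y). fisher_integrand freund p i j x y)
           (if i = j then - freund_fisher_entry p i else 0)"
proof (cases "i = j")
  case True
  have "has_bochner_integral (lborel \<Otimes>\<^sub>M lborel) (\<lambda>z. - (case z of (x, y) \<Rightarrow> freund_part p i x y) / (p $ i)\<^sup>2)
      (- ((if i = 1 \<or> i = 4 then p $ 1 else p $ 3) / (p $ 1 + p $ 3)) / (p $ i)\<^sup>2)"
    by (intro has_bochner_integral_divide_zero has_bochner_integral_minus
        has_bochner_integral_freund_part[OF assms])
  then show ?thesis
    using True by (simp add: fisher_integrand_freund[OF assms] case_prod_unfold freund_fisher_entry_def)
qed (simp add: fisher_integrand_freund[OF assms] case_prod_unfold has_bochner_integral_zero)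

lemma fisher_integrand_freund_outside:
  "x \<notin> {0..} \<or> y \<notin> {0..} \<Longrightarrow> fisher_integrand freund p i j x y = 0"
  by (auto simp: fisher_integrand_def freund_def freund_density_def)

text \<open>Non-integrable functions have integral 0 by convention; joint integrability shows that
  the metric entries are genuine integrals.\<close>

lemma set_integrable_fisher_integrand_freund:
  assumes "p \<in> freund_params"
  shows "set_integrable lborel ({0..} \<times> {0..}) (\<lambda>(x, y). fisher_integrand freund p i j x y)"
proof -
  have "(\<lambda>z. indicator ({0..} \<times> {0..}) z *\<^sub>R (case z of (x, y) \<Rightarrow> fisher_integrand freund p i j x y))
      = (\<lambda>(x, y). fisher_integrand freund p i j x y)"
    using fisher_integrand_freund_outside by (fastforce simp: indicator_def)
  then show ?thesis
    using has_bochner_integral_fisher_integrand_freund[OF assms, of i j]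
    by (simp add: set_integrable_def lborel_prod has_bochner_integral_iff)
qed

lemma fisher_information_freund:
  assumes "p \<in> freund_params"
  shows "fisher_information freund p = diagonal (freund_fisher_entry p)"
proof -
  have "(LBINT y:{0..}. (LBINT x:{0..}. fisher_integrand freund p i j x y))
      = (if i = j then - freund_fisher_entry p i else 0)" for i j
  proof -
    have inner: "indicator {0..} x *\<^sub>R fisher_integrand freund p i j x y = fisher_integrand freund p i j x y"
      "indicator {0..} y *\<^sub>R (\<integral>x. fisher_integrand freund p i j x y \<partial>lborel)
        = (\<integral>x. fisher_integrand freund p i j x y \<partial>lborel)" for x y
      using fisher_integrand_freund_outside by (auto simp: indicator_def)
    show ?thesis
      using has_bochner_integral_fisher_integrand_freund[OF assms, of i j]
      unfolding set_lebesgue_integral_def inner has_bochner_integral_iff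
      \<comment> \<open>The outer integral runs over the second variable, which selects this form of
        Fubini.\<close>
      by (subst lborel_pair.integral_snd) auto
  qed
  then show ?thesis
    by (auto simp: fisher_information_def diagonal_def vec_eq_iff)
qed

section \<open>The Freund manifold\<close>

text \<open>The ratio of the values at \<open>y + 1\<close> and \<open>y\<close> is
  \<open>exp (- b)\<close>, which fixes the rate; either value then fixes the amplitude.\<close>

lemma exp_decay_inject:
  fixes b b' c c' y :: real
  assumes "0 < c" "0 < c'" "c * exp (- b * y) = c' * exp (- b' * y)"
    and "c * exp (- b * (y + 1)) = c' * exp (- b' * (y + 1))"
  shows "b = b'" "c = c'"
proof -
  have "exp (- a * (y + 1)) = exp (- a * y) * exp (- a)" for a :: real
    by (simp add: distrib_left flip: exp_add)
  then have "(c * exp (- b * y)) * exp (- b) = (c * exp (- b * y)) * exp (- b')"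
    using assms(4) by (simp only: assms(3) mult.assoc[symmetric])
  then show "b = b'" using assms(1) by simp
  then show "c = c'" using assms(3) by simp
qed

text \<open>On either axis the density is a single exponential, from which its rate and amplitude are read off.\<close>

lemma inj_on_freund: "inj_on freund freund_params"
proof (rule inj_onI)
  fix p q assume p: "p \<in> freund_params" and q: "q \<in> freund_params" and eq: "freund p = freund q"
  note pos = freund_params_pos[OF p] freund_params_pos[OF q]
  have val: "freund p x y = freund q x y" for x y by (simp add: eq)
  \<comment> \<open>On \<open>x = 0\<close> the branch \<open>x < y\<close> misses the origin, so
    the samples are 1 and 2; on \<open>y = 0\<close> the other branch contains it, and 0 and 1
    serve.\<close>
  have "p $ 1 * p $ 4 * exp (- (p $ 4) * 1) = q $ 1 * q $ 4 * exp (- (q $ 4) * 1)"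
    "p $ 1 * p $ 4 * exp (- (p $ 4) * (1 + 1)) = q $ 1 * q $ 4 * exp (- (q $ 4) * (1 + 1))"
    using val[of 0 1] val[of 0 "1 + 1"] by (simp_all add: freund_def freund_density_def)
  from exp_decay_inject[OF mult_pos_pos mult_pos_pos this, OF pos(1,1,2,2)]
  have lower: "p $ 4 = q $ 4" "p $ 1 * p $ 4 = q $ 1 * q $ 4" .
  have "p $ 3 * p $ 2 * exp (- (p $ 2) * 0) = q $ 3 * q $ 2 * exp (- (q $ 2) * 0)"
    "p $ 3 * p $ 2 * exp (- (p $ 2) * (0 + 1)) = q $ 3 * q $ 2 * exp (- (q $ 2) * (0 + 1))"
    using val[of 0 0] val[of 1 0] by (simp_all add: freund_def freund_density_def)
  from exp_decay_inject[OF mult_pos_pos mult_pos_pos this, OF pos(1,1,2,2)]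
  have upper: "p $ 2 = q $ 2" "p $ 3 * p $ 2 = q $ 3 * q $ 2" .
  show "p = q"
    using lower upper pos(2)[of 2] pos(2)[of 4] by (simp add: vec_eq_iff forall_4)
qed

lemma freund_coords_freund: "p \<in> freund_params \<Longrightarrow> freund_coords (freund p) = p"
  unfolding freund_coords_def using inj_on_freund by (rule inv_into_f_f)

lemma bij_betw_freund_coords: "bij_betw freund_coords freund_family freund_params"
  unfolding freund_coords_def freund_family_def
  by (intro bij_betw_inv_into inj_on_imp_bij_betw inj_on_freund)

lemma freund_coords_image: "freund_coords ` freund_family = freund_params"
  using bij_betw_freund_coords by (simp add: bij_betw_def)

text \<open>Inverting the inverse returns \<open>freund\<close>, though only on
  \<open>freund_params\<close>; this makes chart expressions explicit.\<close>

lemma inv_freund_coords: "p \<in> freund_params \<Longrightarrow> inv_into freund_family freund_coords p = freund p"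
  using bij_betw_freund_coords
  by (intro inv_into_f_eq) (auto simp: bij_betw_def freund_family_def freund_coords_freund)

section \<open>Topology and smooth structure of the family\<close>

lemma topspace_freund_topology: "topspace freund_topology = freund_family"
  by (simp add: freund_topology_def topspace_pullback_topology)

text \<open>The pullback topology makes the coordinates continuous by construction;
  \<open>freund\<close> is continuous into it because its composite with the coordinates is the
  identity.\<close>

lemma homeomorphic_map_freund_coords:
  "homeomorphic_map freund_topology (top_of_set freund_params) freund_coords"
proof -
  have "continuous_map freund_topology euclidean (id \<circ> freund_coords)"
    unfolding freund_topology_def by (rule continuous_map_pullback) simp
  then have 1: "continuous_map freund_topology (top_of_set freund_params) freund_coords"
    using freund_coords_image by (auto simp: continuous_map_in_subtopology topspace_freund_topology)
  have "continuous_map (top_of_set freund_params) euclidean (freund_coords \<circ> freund)"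
    using freund_coords_freund by (auto intro: continuous_on_eq[OF continuous_on_id])
  then have 2: "continuous_map (top_of_set freund_params) freund_topology freund"
    unfolding freund_topology_def
    by (rule continuous_map_pullback') (auto simp: freund_family_def)
  show ?thesis
    unfolding homeomorphic_map_maps homeomorphic_maps_def topspace_freund_topology
    using 1 2 by (intro exI[of _ freund]) (auto simp: freund_coords_freund freund_family_def)
qed

lemma second_countable_euclidean:
  "second_countable (euclidean :: 'a::second_countable_topology topology)"
proof -
  obtain \<B> :: "'a set set" where \<B>: "countable \<B>" "topological_basis \<B>"
    using ex_countable_basis by metis
  have "\<exists>V\<in>\<B>. x \<in> V \<and> V \<subseteq> U" if "open U" "x \<in> U" for U x
    using topological_basisE[OF \<B>(2) that] by metis
  then show ?thesis
    unfolding second_countable_def using \<B> by (metis open_openin topological_basis_open)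
qed

text \<open>The only transition map is the identity, and both topological axioms are transported
  from the parameter set along the homeomorphism.\<close>

lemma smooth_manifold_freund: "smooth_manifold freund_topology freund_atlas"
proof -
  note homeo = homeomorphic_map_imp_homeomorphic_space[OF homeomorphic_map_freund_coords]
  have "subtopology freund_topology freund_family = freund_topology"
    by (metis subtopology_topspace topspace_freund_topology)
  then have "is_chart freund_topology (freund_family, freund_coords)"
    using homeomorphic_map_freund_coords topspace_freund_topology openin_topspace[of freund_topology]
    by (auto simp: is_chart_def freund_coords_image open_freund_params)
  moreover have "smooth_on freund_params (freund_coords \<circ> inv_into freund_family freund_coords)"
    unfolding smooth_on_def
    using open_freund_params Ck_on_bounded_linear[OF open_freund_params bounded_linear_ident]
    by (auto intro: Ck_on_cong[of _ "\<lambda>x. x"] simp: inv_freund_coords freund_coords_freund)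
  ultimately have "smooth_atlas freund_topology freund_atlas"
    by (simp add: smooth_atlas_def freund_atlas_def topspace_freund_topology freund_coords_image)
  moreover have "second_countable (top_of_set freund_params)"
    by (intro second_countable_subtopology second_countable_euclidean)
  ultimately show ?thesis
    using homeomorphic_Hausdorff_space[OF homeo] homeomorphic_space_second_countability[OF homeo]
    by (simp add: smooth_manifold_def Hausdorff_space_subtopology)
qed

section \<open>The Fisher metric as a Riemannian metric\<close>

lemma fisher_metric_freund:
  assumes "p \<in> freund_params"
  shows "fisher_metric (freund_family, freund_coords) (freund p) = fisher_information freund p"
  \<comment> \<open>The chart inverse equals \<open>freund\<close> only on the parameter set, which
    suffices for derivatives because that set is open.\<close>
  using assms inv_freund_coords
  by (auto simp: fisher_metric_def freund_coords_freund intro: fisher_information_cong[OF open_freund_params])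

lemma freund_fisher_entry_pos: "p \<in> freund_params \<Longrightarrow> 0 < freund_fisher_entry p i"
  using freund_params_pos[of p]
  by (auto simp: freund_fisher_entry_def less_imp_neq[symmetric] intro!: divide_pos_pos mult_pos_pos add_pos_pos)

text \<open>The entries are rational functions whose denominators do not vanish for positive
  parameters.\<close>

lemma smooth_on_fisher_information_freund: "smooth_on freund_params (fisher_information freund)"
  unfolding smooth_on_def
proof (intro conjI allI)
  fix k
  have nz: "q $ 1 + q $ 3 \<noteq> 0" "q $ i \<noteq> 0" if "q \<in> freund_params" for q i
    using freund_params_pos[OF that] add_pos_pos[of "q $ 1" "q $ 3"] by (auto simp: less_imp_neq[symmetric])
  have "Ck_on k freund_params (\<lambda>p. p $ l * inverse ((p $ 1 + p $ 3) * (p $ i * p $ i)))" for l i :: 4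
    using nz by (intro Ck_on_mult Ck_on_inverse Ck_on_add Ck_on_nth open_freund_params) auto
  then have "Ck_on k freund_params (\<lambda>p. freund_fisher_entry p i)" for i
    by (cases "i = 1 \<or> i = 4") (auto simp: freund_fisher_entry_def divide_inverse power2_eq_square)
  then have "Ck_on k freund_params (\<lambda>p. diagonal (freund_fisher_entry p) $ i $ j)" for i j
    by (cases "i = j") (simp_all add: diagonal_def Ck_on_const open_freund_params)
  then have "Ck_on k freund_params (\<lambda>p. diagonal (freund_fisher_entry p))"
    by (intro Ck_on_vec open_freund_params)
  then show "Ck_on k freund_params (fisher_information freund)"
    using fisher_information_freund by (auto intro: Ck_on_cong[OF open_freund_params])
qed (rule open_freund_params)

text \<open>With one chart the Jacobian \<open>J\<close> is the unit matrix, so the tensor law is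
  immediate; definiteness comes from the positive diagonal.\<close>

lemma riemannian_metric_freund: "riemannian_metric freund_atlas fisher_metric"
proof -
  have smooth: "smooth_on freund_params
      (\<lambda>p. fisher_metric (freund_family, freund_coords) (inv_into freund_family freund_coords p))"
    using smooth_on_fisher_information_freund unfolding smooth_on_def
    by (auto intro: Ck_on_cong[of _ "fisher_information freund"] simp: inv_freund_coords fisher_metric_freund)
  have J: "matrix (frechet_derivative (freund_coords \<circ> inv_into freund_family freund_coords) (at p)) = mat 1"
    if "p \<in> freund_params" for p
  proof -
    have "frechet_derivative (\<lambda>x. x) (at p)
        = frechet_derivative (freund_coords \<circ> inv_into freund_family freund_coords) (at p)"
      using that by (intro frechet_derivative_transform_within_open[OF _ open_freund_params])
        (auto simp: inv_freund_coords freund_coords_freund)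
    then show ?thesis by (simp add: matrix_id_mat_1 flip: id_def)
  qed
  have metric: "fisher_metric (freund_family, freund_coords) P = diagonal (freund_fisher_entry (freund_coords P))"
    "freund_coords P \<in> freund_params" if "P \<in> freund_family" for P
    using that by (auto simp: freund_family_def fisher_metric_freund[unfolded freund_family_def]
        fisher_information_freund freund_coords_freund)
  show ?thesis
    unfolding riemannian_metric_def freund_atlas_def
    using smooth
    by (auto simp: metric J freund_coords_image transpose_mat Let_def
        intro!: diagonal_pos_def freund_fisher_entry_pos)
qed

lemma riemannian_manifold_freund: "riemannian_manifold freund_topology freund_atlas fisher_metric"
  by (simp add: riemannian_manifold_def smooth_manifold_freund riemannian_metric_freund)

text \<open>The branch of the density depends on \<open>x\<close> and \<open>y\<close> alone, so for
  a fixed point one formula holds for all parameters.\<close>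

lemma smooth_on_ln_freund:
  assumes "0 \<le> x" "0 \<le> y"
  shows "smooth_on freund_params (\<lambda>p. ln (freund p x y))"
  unfolding smooth_on_def
proof (intro conjI allI)
  fix k
  \<comment> \<open>The linear part is regrouped into constants times coordinates; \<open>u\<close>
    is the smaller variable and \<open>v\<close> the larger.\<close>
  have *: "Ck_on k freund_params
      (\<lambda>q. ln (q $ a) + ln (q $ b) + (u - v) * q $ b + (- u) * (q $ 1 + q $ 3))" for a b :: 4 and u v
    by (intro Ck_on_add Ck_on_mult Ck_on_const Ck_on_ln Ck_on_nth open_freund_params freund_params_pos)
  show "Ck_on k freund_params (\<lambda>p. ln (freund p x y))"
  proof (cases "x < y")
    case True
    show ?thesis
      by (rule Ck_on_cong[OF open_freund_params _ *[of 1 4 x y]])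
        (simp add: ln_freund_lower[OF assms(1) True] algebra_simps)
  next
    case False
    then have "y \<le> x" by simp
    show ?thesis
      by (rule Ck_on_cong[OF open_freund_params _ *[of 3 2 y x]])
        (simp add: ln_freund_upper[OF assms(2) \<open>y \<le> x\<close>] algebra_simps)
  qed
qed (rule open_freund_params)

section \<open>Explicit matrices in the four parameters\<close>

context
  fixes \<alpha>1 \<beta>1 \<alpha>2 \<beta>2 :: real
  assumes pos: "0 < \<alpha>1 \<and> 0 < \<beta>1 \<and> 0 < \<alpha>2 \<and> 0 < \<beta>2"
begin

lemma vector_in_freund_params: "vector [\<alpha>1, \<beta>1, \<alpha>2, \<beta>2] \<in> freund_params"
  using pos by (simp add: freund_params_def forall_4 vector_4)

lemma freund_coords_freund_density:
  "freund_coords (freund_density \<alpha>1 \<beta>1 \<alpha>2 \<beta>2) = vector [\<alpha>1, \<beta>1, \<alpha>2, \<beta>2]"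
  using freund_coords_freund[OF vector_in_freund_params] by (simp add: freund_def vector_4)

lemma fisher_information_freund_vector:
  "fisher_information freund (vector [\<alpha>1, \<beta>1, \<alpha>2, \<beta>2]) =
     vector [vector [1 / (\<alpha>1\<^sup>2 + \<alpha>1 * \<alpha>2), 0, 0, 0],
             vector [0, \<alpha>2 / (\<beta>1\<^sup>2 * (\<alpha>1 + \<alpha>2)), 0, 0],
             vector [0, 0, 1 / (\<alpha>2\<^sup>2 + \<alpha>1 * \<alpha>2), 0],
             vector [0, 0, 0, \<alpha>1 / (\<beta>2\<^sup>2 * (\<alpha>1 + \<alpha>2))]]"
proof -
  \<comment> \<open>In the two \<alpha> entries the mass of the region shares a factor with the
    squared parameter.\<close>
  have "\<alpha>1 / ((\<alpha>1 + \<alpha>2) * \<alpha>1\<^sup>2) = 1 / (\<alpha>1\<^sup>2 + \<alpha>1 * \<alpha>2)"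
    "\<alpha>2 / ((\<alpha>1 + \<alpha>2) * \<alpha>2\<^sup>2) = 1 / (\<alpha>2\<^sup>2 + \<alpha>1 * \<alpha>2)"
    using pos by (simp_all add: power2_eq_square flip: distrib_left distrib_right)
  then show ?thesis
    unfolding fisher_information_freund[OF vector_in_freund_params] diagonal_4
    by (simp add: freund_fisher_entry_def vector_4 mult.commute)
qed

lemma matrix_inv_fisher_information_freund:
  "invertible (fisher_information freund (vector [\<alpha>1, \<beta>1, \<alpha>2, \<beta>2]))"
  "matrix_inv (fisher_information freund (vector [\<alpha>1, \<beta>1, \<alpha>2, \<beta>2])) =
     vector [vector [\<alpha>1\<^sup>2 + \<alpha>1 * \<alpha>2, 0, 0, 0],
             vector [0, \<beta>1\<^sup>2 * (\<alpha>1 + \<alpha>2) / \<alpha>2, 0, 0],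
             vector [0, 0, \<alpha>2\<^sup>2 + \<alpha>1 * \<alpha>2, 0],
             vector [0, 0, 0, \<beta>2\<^sup>2 * (\<alpha>1 + \<alpha>2) / \<alpha>1]]"
proof -
  have nz: "freund_fisher_entry (vector [\<alpha>1, \<beta>1, \<alpha>2, \<beta>2]) i \<noteq> 0" for i
    using freund_fisher_entry_pos[OF vector_in_freund_params, of i] by simp
  note inv = invertible_diagonal[of "freund_fisher_entry (vector [\<alpha>1, \<beta>1, \<alpha>2, \<beta>2])", OF nz]
  show "invertible (fisher_information freund (vector [\<alpha>1, \<beta>1, \<alpha>2, \<beta>2]))"
    by (simp add: fisher_information_freund[OF vector_in_freund_params] inv)
  have "1 / (\<alpha>1 / ((\<alpha>1 + \<alpha>2) * \<alpha>1\<^sup>2)) = \<alpha>1\<^sup>2 + \<alpha>1 * \<alpha>2"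
    "1 / (\<alpha>2 / ((\<alpha>1 + \<alpha>2) * \<alpha>2\<^sup>2)) = \<alpha>2\<^sup>2 + \<alpha>1 * \<alpha>2"
    using pos by (simp_all add: power2_eq_square field_simps)
  then show "matrix_inv (fisher_information freund (vector [\<alpha>1, \<beta>1, \<alpha>2, \<beta>2])) =
     vector [vector [\<alpha>1\<^sup>2 + \<alpha>1 * \<alpha>2, 0, 0, 0],
             vector [0, \<beta>1\<^sup>2 * (\<alpha>1 + \<alpha>2) / \<alpha>2, 0, 0],
             vector [0, 0, \<alpha>2\<^sup>2 + \<alpha>1 * \<alpha>2, 0],
             vector [0, 0, 0, \<beta>2\<^sup>2 * (\<alpha>1 + \<alpha>2) / \<alpha>1]]"
    \<comment> \<open>The inverse is taken while the matrix still has the form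
      \<open>diagonal\<close>; only then are the entries written out.\<close>
    unfolding fisher_information_freund[OF vector_in_freund_params] inv unfolding diagonal_4
    by (simp add: freund_fisher_entry_def vector_4 mult.commute)
qed

end

theorem proposition1p1:
  shows
    \<comment> \<open>1: the parameters are a global coordinate system, making the family a 4-manifold\<close>
    "(bij_betw freund_coords freund_family freund_params \<and>
      (\<forall>\<alpha>1 \<beta>1 \<alpha>2 \<beta>2. 0 < \<alpha>1 \<and> 0 < \<beta>1 \<and> 0 < \<alpha>2 \<and> 0 < \<beta>2 \<longrightarrow>
         freund_coords (freund_density \<alpha>1 \<beta>1 \<alpha>2 \<beta>2) = vector [\<alpha>1, \<beta>1, \<alpha>2, \<beta>2]) \<and>
      topspace freund_topology = freund_family \<and>
      smooth_manifold freund_topology freund_atlas)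
     \<and>
     \<comment> \<open>2: the Fisher information metric is well defined, Riemannian and of the stated form\<close>
     ((\<forall>x\<ge>0. \<forall>y\<ge>0. smooth_on freund_params (\<lambda>p. ln (freund p x y))) \<and>
      (\<forall>p\<in>freund_params. \<forall>i j.
         set_integrable lborel ({0..} \<times> {0..}) (\<lambda>(x, y). fisher_integrand freund p i j x y)) \<and>
      (\<forall>p\<in>freund_params.
         fisher_metric (freund_family, freund_coords) (freund p) = fisher_information freund p) \<and>
      riemannian_manifold freund_topology freund_atlas fisher_metric \<and>
      (\<forall>\<alpha>1 \<beta>1 \<alpha>2 \<beta>2. 0 < \<alpha>1 \<and> 0 < \<beta>1 \<and> 0 < \<alpha>2 \<and> 0 < \<beta>2 \<longrightarrow>
         fisher_information freund (vector [\<alpha>1, \<beta>1, \<alpha>2, \<beta>2]) =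
         vector [vector [1 / (\<alpha>1\<^sup>2 + \<alpha>1 * \<alpha>2), 0, 0, 0],
                 vector [0, \<alpha>2 / (\<beta>1\<^sup>2 * (\<alpha>1 + \<alpha>2)), 0, 0],
                 vector [0, 0, 1 / (\<alpha>2\<^sup>2 + \<alpha>1 * \<alpha>2), 0],
                 vector [0, 0, 0, \<alpha>1 / (\<beta>2\<^sup>2 * (\<alpha>1 + \<alpha>2))]]))
     \<and>
     \<comment> \<open>3: the inverse matrix\<close>
     (\<forall>\<alpha>1 \<beta>1 \<alpha>2 \<beta>2. 0 < \<alpha>1 \<and> 0 < \<beta>1 \<and> 0 < \<alpha>2 \<and> 0 < \<beta>2 \<longrightarrow>
        invertible (fisher_information freund (vector [\<alpha>1, \<beta>1, \<alpha>2, \<beta>2])) \<and>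
        matrix_inv (fisher_information freund (vector [\<alpha>1, \<beta>1, \<alpha>2, \<beta>2])) =
        vector [vector [\<alpha>1\<^sup>2 + \<alpha>1 * \<alpha>2, 0, 0, 0],
                vector [0, \<beta>1\<^sup>2 * (\<alpha>1 + \<alpha>2) / \<alpha>2, 0, 0],
                vector [0, 0, \<alpha>2\<^sup>2 + \<alpha>1 * \<alpha>2, 0],
                vector [0, 0, 0, \<beta>2\<^sup>2 * (\<alpha>1 + \<alpha>2) / \<alpha>1]])"
  by (intro conjI allI impI ballI;
      (rule bij_betw_freund_coords freund_coords_freund_density topspace_freund_topology
        smooth_manifold_freund smooth_on_ln_freund set_integrable_fisher_integrand_freund
        fisher_metric_freund riemannian_manifold_freund fisher_information_freund_vector
        matrix_inv_fisher_information_freund; assumption?))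

end
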